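(* Let $\Sigma$ be an arbitrary group, let $\kappa$ be an infinite cardinal, let $K$ be a $\kappa$-closed difference field (with respect to $\Sigma$), and let $Y$ be a set such that $|Y|\leqslant\kappa$. Then, for every perfect difference ideal $\mathfrak t\subseteq K\{Y\}$, the equality $\mathfrak t=I(V(\mathfrak t))$ holds.
   Context: Fix a group $\Sigma$. A difference ring is a commutative associative ring with $1$ on which $\Sigma$ acts by ring automorphisms; a difference field (difference integral domain) is a difference ring that is a field (integral domain). A difference ideal is an ideal $\mathfrak a$ with $\sigma(\mathfrak a)\subseteq\mathfrak a$ for all $\sigma\in\Sigma$. A difference ideal $\mathfrak a$ of $A$ is perfect if for all $a\in A$, $r\ge 1$, $\tau_1,\dots,\tau_r\in\Sigma$ and positive integers $k_1,\dots,k_r$, $\tau_1(a)^{k_1}\cdots\tau_r(a)^{k_r}\in\mathfrak a$ implies $a\in\mathfrak a$. For a difference ring $A$ and a set $Y$, the ring of difference polynomials $A\{Y\}$ is the polynomial ring over $A$ in the variables $\sigma y$ ($\sigma\in\Sigma$, $y\in Y$), with $\Sigma$ acting on $A$ as given and on variables by $\sigma(\tau y)=(\sigma\tau)y$. If $B$ is a difference ring containing $A$ as a difference subring, $f\in A\{Y\}$ is evaluated at a point $b\in B^Y$ by substituting $\sigma(b_y)$ for $\sigma y$; $b$ is a common zero of $E\subseteq A\{Y\}$ if all $f\in E$ vanish at $b$. For $E\subseteq A\{Y\}$, $V(E)\subseteq A^Y$ is the set of all common zeros of $E$ in $A^Y$; for $X\subseteq A^Y$, $I(X)\subseteq A\{Y\}$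 is the set of all difference polynomials vanishing at every point of $X$. Let $Z$ be a set of cardinality $\kappa$. A difference field $A$ is called $\kappa$-closed (or $\kappa$-difference closed) if it satisfies the following two conditions (which are equivalent for difference integral domains): (B1) for every proper perfect difference ideal $\mathfrak a\subseteq A\{Z\}$, there exists a common zero for $\mathfrak a$ in $A^Z$; (B2) for every subset $E\subseteq A\{Z\}$, if there is a common zero for $E$ in $B^Z$, where $B$ is a difference integral domain containing $A$, then there is a common zero for $E$ in $A^Z$. *)

theory Defs
  imports
    "HOL-Algebra.QuotRing"
    "HOL-Algebra.Algebraic_Closure_Type"
    "HOL-Library.Poly_Mapping"
begin

unbundle cardinal_syntax

(* The acting group is a type of class group_add: the group is written additively, but
   this class does not assume commutativity.  An action is a function 'g \<Rightarrow> 'b \<Rightarrow> 'b. *)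

definition difference_ring :: "('g::group_add \<Rightarrow> 'b \<Rightarrow> 'b) \<Rightarrow> 'b ring \<Rightarrow> bool" where
  "difference_ring act R \<longleftrightarrow>
     cring R \<and>
     (\<forall>\<sigma>. act \<sigma> \<in> ring_iso R R) \<and>
     (\<forall>x\<in>carrier R. act 0 x = x) \<and>
     (\<forall>\<sigma> \<tau>. \<forall>x\<in>carrier R. act (\<sigma> + \<tau>) x = act \<sigma> (act \<tau> x))"

definition difference_field :: "('g::group_add \<Rightarrow> 'b \<Rightarrow> 'b) \<Rightarrow> 'b ring \<Rightarrow> bool" where
  "difference_field act R \<longleftrightarrow> difference_ring act R \<and> field R"

definition difference_domain :: "('g::group_add \<Rightarrow> 'b \<Rightarrow> 'b) \<Rightarrow> 'b ring \<Rightarrow> bool" where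
  "difference_domain act R \<longleftrightarrow> difference_ring act R \<and> domain R"

definition difference_embedding ::
  "('a \<Rightarrow> 'b) \<Rightarrow> ('g::group_add \<Rightarrow> 'a \<Rightarrow> 'a) \<Rightarrow> 'a ring \<Rightarrow> ('g \<Rightarrow> 'b \<Rightarrow> 'b) \<Rightarrow> 'b ring \<Rightarrow> bool" where
  "difference_embedding \<iota> act A actB B \<longleftrightarrow>
     \<iota> \<in> ring_hom A B \<and> inj_on \<iota> (carrier A) \<and>
     (\<forall>\<sigma>. \<forall>x\<in>carrier A. \<iota> (act \<sigma> x) = actB \<sigma> (\<iota> x))"

definition difference_ideal ::
  "('g::group_add \<Rightarrow> 'b \<Rightarrow> 'b) \<Rightarrow> 'b set \<Rightarrow> 'b ring \<Rightarrow> bool" where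
  "difference_ideal act \<aa> R \<longleftrightarrow> ideal \<aa> R \<and> (\<forall>\<sigma>. act \<sigma> ` \<aa> \<subseteq> \<aa>)"

definition perfect_difference_ideal ::
  "('g::group_add \<Rightarrow> 'b \<Rightarrow> 'b) \<Rightarrow> 'b set \<Rightarrow> 'b ring \<Rightarrow> bool" where
  "perfect_difference_ideal act \<aa> R \<longleftrightarrow>
     difference_ideal act \<aa> R \<and>
     (\<forall>a\<in>carrier R. \<forall>r\<ge>1. \<forall>(\<tau>::nat \<Rightarrow> 'g) (k::nat \<Rightarrow> nat).
        (\<forall>i\<in>{1..r}. k i > 0) \<longrightarrow>
        (\<Otimes>\<^bsub>R\<^esub>i\<in>{1..r}. act (\<tau> i) a [^]\<^bsub>R\<^esub> k i) \<in> \<aa> \<longrightarrow> a \<in> \<aa>)"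

(* The variable \<sigma>y is the pair (\<sigma>, y); a monomial maps variables to exponents. *)

type_synonym ('g, 'y) dmonom = "('g \<times> 'y) \<Rightarrow>\<^sub>0 nat"

type_synonym ('g, 'y, 'a) dpoly = "('g, 'y) dmonom \<Rightarrow>\<^sub>0 'a"

(* K{Y}, as a subring of the polynomial ring in all variables of type 'g \<times> 'y. *)
definition dpoly_ring :: "'y set \<Rightarrow> ('g, 'y, 'a::field) dpoly ring" where
  "dpoly_ring Y =
     ring_of_type_algebra\<lparr>carrier := {p. \<forall>m\<in>Poly_Mapping.keys p. Poly_Mapping.keys m \<subseteq> UNIV \<times> Y}\<rparr>"

definition dmonom_act :: "'g::group_add \<Rightarrow> ('g, 'y) dmonom \<Rightarrow> ('g, 'y) dmonom" where
  "dmonom_act \<sigma> m = (\<Sum>(\<tau>, y)\<in>Poly_Mapping.keys m. Poly_Mapping.single (\<sigma> + \<tau>, y) (Poly_Mapping.lookup m (\<tau>, y)))"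

definition dpoly_act ::
  "('g::group_add \<Rightarrow> 'a \<Rightarrow> 'a) \<Rightarrow> 'g \<Rightarrow> ('g, 'y, 'a::field) dpoly \<Rightarrow> ('g, 'y, 'a) dpoly" where
  "dpoly_act act \<sigma> p =
     (\<Sum>m\<in>Poly_Mapping.keys p. Poly_Mapping.single (dmonom_act \<sigma> m) (act \<sigma> (Poly_Mapping.lookup p m)))"

(* Evaluation at b of a polynomial with coefficients in K, where \<iota> embeds K into the
   difference ring B with action actB. *)
definition dpoly_eval ::
  "('a \<Rightarrow> 'b) \<Rightarrow> ('g \<Rightarrow> 'b \<Rightarrow> 'b) \<Rightarrow> 'b ring \<Rightarrow> ('y \<Rightarrow> 'b) \<Rightarrow> ('g, 'y, 'a::field) dpoly \<Rightarrow> 'b" where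
  "dpoly_eval \<iota> actB B b p =
     (\<Oplus>\<^bsub>B\<^esub>m\<in>Poly_Mapping.keys p. \<iota> (Poly_Mapping.lookup p m) \<otimes>\<^bsub>B\<^esub>
        (\<Otimes>\<^bsub>B\<^esub>v\<in>Poly_Mapping.keys m. actB (fst v) (b (snd v)) [^]\<^bsub>B\<^esub> Poly_Mapping.lookup m v))"

definition common_zeros ::
  "('a \<Rightarrow> 'b) \<Rightarrow> ('g \<Rightarrow> 'b \<Rightarrow> 'b) \<Rightarrow> 'b ring \<Rightarrow> 'y set \<Rightarrow> ('g, 'y, 'a::field) dpoly set
     \<Rightarrow> ('y \<Rightarrow> 'b) set" where
  "common_zeros \<iota> actB B Y E =
     {b \<in> Y \<rightarrow>\<^sub>E carrier B. \<forall>p\<in>E. dpoly_eval \<iota> actB B b p = \<zero>\<^bsub>B\<^esub>}"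

definition zero_set ::
  "('g \<Rightarrow> 'a \<Rightarrow> 'a) \<Rightarrow> 'y set \<Rightarrow> ('g, 'y, 'a::field) dpoly set \<Rightarrow> ('y \<Rightarrow> 'a) set" where
  "zero_set act Y E = common_zeros (\<lambda>a. a) act ring_of_type_algebra Y E"

definition vanishing_ideal ::
  "('g \<Rightarrow> 'a \<Rightarrow> 'a) \<Rightarrow> 'y set \<Rightarrow> ('y \<Rightarrow> 'a) set \<Rightarrow> ('g, 'y, 'a::field) dpoly set" where
  "vanishing_ideal act Y S =
     {p \<in> carrier (dpoly_ring Y). \<forall>b\<in>S. dpoly_eval (\<lambda>a. a) act ring_of_type_algebra b p = 0}"

definition closed_B1 :: "('g::group_add \<Rightarrow> 'a \<Rightarrow> 'a::field) \<Rightarrow> 'z set \<Rightarrow> bool" where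
  "closed_B1 act Z \<longleftrightarrow>
     (\<forall>\<aa> :: ('g, 'z, 'a) dpoly set.
        perfect_difference_ideal (dpoly_act act) \<aa> (dpoly_ring Z) \<and>
        \<aa> \<noteq> carrier (dpoly_ring Z) \<longrightarrow> zero_set act Z \<aa> \<noteq> {})"

(* HOL cannot quantify over all types, so the carrier of B is a subset of the type of
   K{Z}.  This loses no generality: given a common zero b in an arbitrary difference domain
   containing K, one may replace the latter by its difference subring generated by K
   and b, which is a quotient of K{Z} and hence is isomorphic to a ring carried by a set of
   representatives in K{Z}. *)
definition closed_B2 :: "('g::group_add \<Rightarrow> 'a \<Rightarrow> 'a::field) \<Rightarrow> 'z set \<Rightarrow> bool" where
  "closed_B2 act Z \<longleftrightarrow>
     (\<forall>E \<subseteq> carrier (dpoly_ring Z :: ('g, 'z, 'a) dpoly ring).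
        (\<exists>(B :: ('g, 'z, 'a) dpoly ring) actB \<iota>.
           difference_domain actB B \<and>
           difference_embedding \<iota> act ring_of_type_algebra actB B \<and>
           common_zeros \<iota> actB B Z E \<noteq> {})
        \<longrightarrow> zero_set act Z E \<noteq> {})"

(* With Z a set of cardinality \<kappa>: the field 'a with the action act is \<kappa>-closed. *)
definition closed_difference_field ::
  "('g::group_add \<Rightarrow> 'a \<Rightarrow> 'a::field) \<Rightarrow> 'z set \<Rightarrow> bool" where
  "closed_difference_field act Z \<longleftrightarrow>
     difference_field act ring_of_type_algebra \<and> closed_B1 act Z \<and> closed_B2 act Z"

end

theory Submission
  imports Defs
begin

text \<open>
  Rabinowitsch trick. Let \<open>f \<notin> \<tt>\<close> and let \<open>S\<close> be the multiplicative monoid generated by the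
  \<open>\<sigma> f\<close>. Perfectness says that \<open>S\<close> does not meet \<open>\<tt>\<close>, so \<open>B = S\<inverse>(K{Y}/\<tt>)\<close> is nonzero, and
  that the zero ideal of \<open>B\<close> is perfect. As \<open>\<kappa>\<close> is infinite, \<open>Y\<close> and a spare variable \<open>w\<close> embed
  into \<open>Z\<close>. The kernel of the homomorphism \<open>K{Z} \<rightarrow> B\<close> with \<open>w \<mapsto> 1/f\<close> is a proper perfect
  difference ideal, hence has a zero in \<open>K\<^sup>Z\<close> by (B1); its \<open>Y\<close>-part is a zero of \<open>\<tt>\<close> at which \<open>f\<close>
  does not vanish.
\<close>

section \<open>Evaluation of polynomials\<close>

lemma carrier_dpoly_ring:
  "p \<in> carrier (dpoly_ring Y) \<longleftrightarrow> (\<forall>m\<in>Poly_Mapping.keys p. Poly_Mapping.keys m \<subseteq> UNIV \<times> Y)"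
  by (simp add: dpoly_ring_def)

lemma type_ring_simps [simp]:
  "carrier (ring_of_type_algebra :: 'a::comm_ring_1 ring) = UNIV"
  "monoid.mult (ring_of_type_algebra :: 'a ring) = (*)"
  "monoid.one (ring_of_type_algebra :: 'a ring) = 1"
  "ring.zero (ring_of_type_algebra :: 'a ring) = 0"
  "ring.add (ring_of_type_algebra :: 'a ring) = (+)"
  by (simp_all add: ring_of_type_algebra_def)

lemma dpoly_ring_simps [simp]:
  "monoid.mult (dpoly_ring Y :: ('g, 'y, 'a::field) dpoly ring) = (*)"
  "monoid.one (dpoly_ring Y :: ('g, 'y, 'a) dpoly ring) = 1"
  "ring.zero (dpoly_ring Y :: ('g, 'y, 'a) dpoly ring) = 0"
  "ring.add (dpoly_ring Y :: ('g, 'y, 'a) dpoly ring) = (+)"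
  by (simp_all add: dpoly_ring_def)

lemma type_ring_hom_iff:
  "h \<in> ring_hom (ring_of_type_algebra :: 'a::comm_ring_1 ring) (ring_of_type_algebra :: 'b::comm_ring_1 ring)
     \<longleftrightarrow> (\<forall>x y. h (x + y) = h x + h y) \<and> (\<forall>x y. h (x * y) = h x * h y) \<and> h 1 = 1"
  by (auto simp: ring_hom_def)

text \<open>Updating at a key outside the support is the same as adding a single term, so
  \<open>update_induct\<close> can be recast in the additive form that suits additive maps.\<close>

lemma poly_mapping_single_induct [case_names zero add]:
  fixes p :: "'a \<Rightarrow>\<^sub>0 'b::comm_monoid_add"
  assumes "P 0" and "\<And>p m a. P p \<Longrightarrow> P (p + Poly_Mapping.single m a)"
  shows "P p"
proof (induction p rule: update_induct)
  case const
  then show ?case using assms(1) by simp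
next
  case (update p m a)
  have "Poly_Mapping.update m a p = p + Poly_Mapping.single m a"
    using update(1)
    by (intro poly_mapping_eqI)
       (auto simp: lookup_update lookup_add lookup_single when_def in_keys_iff)
  then show ?case using update assms(2) by simp
qed

definition monom_eval :: "('b, 'n) ring_scheme \<Rightarrow> ('v \<Rightarrow> 'b) \<Rightarrow> ('v \<Rightarrow>\<^sub>0 nat) \<Rightarrow> 'b" where
  "monom_eval B c m =
     (\<Otimes>\<^bsub>B\<^esub>v\<in>Poly_Mapping.keys m. c v [^]\<^bsub>B\<^esub> Poly_Mapping.lookup m v)"

text \<open>The general substitution, with an independent value \<open>c v\<close> for each
  variable. Evaluation at a difference point, the action of the group, and restriction and renaming
  of variables are all instances, so the homomorphism property is proved only once.\<close>

definition poly_eval ::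
  "('b, 'n) ring_scheme \<Rightarrow> ('a \<Rightarrow> 'b) \<Rightarrow> ('v \<Rightarrow> 'b) \<Rightarrow> (('v \<Rightarrow>\<^sub>0 nat) \<Rightarrow>\<^sub>0 'a::comm_ring_1) \<Rightarrow> 'b"
  where
  "poly_eval B \<iota> c p =
     (\<Oplus>\<^bsub>B\<^esub>m\<in>Poly_Mapping.keys p. \<iota> (Poly_Mapping.lookup p m) \<otimes>\<^bsub>B\<^esub> monom_eval B c m)"

lemma dpoly_eval_eq_poly_eval:
  "dpoly_eval \<iota> actB B b = poly_eval B \<iota> (\<lambda>v. actB (fst v) (b (snd v)))"
  by (simp add: fun_eq_iff dpoly_eval_def poly_eval_def monom_eval_def)

abbreviation pconst :: "'a \<Rightarrow> ('v \<Rightarrow>\<^sub>0 nat) \<Rightarrow>\<^sub>0 'a::comm_ring_1" where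
  "pconst a \<equiv> Poly_Mapping.single 0 a"

abbreviation pvar :: "'v \<Rightarrow> ('v \<Rightarrow>\<^sub>0 nat) \<Rightarrow>\<^sub>0 'a::comm_ring_1" where
  "pvar v \<equiv> Poly_Mapping.single (Poly_Mapping.single v (Suc 0)) 1"

text \<open>Only variables occurring in \<open>p\<close> contribute. Membership of \<open>p\<close>
  in K{Y} is exploited through this: values at variables outside \<open>Y\<close> may be altered
  freely.\<close>

lemma poly_eval_cong:
  assumes "\<And>a. \<iota> a = \<iota>' a" and "\<And>m v. m \<in> Poly_Mapping.keys p \<Longrightarrow> v \<in> Poly_Mapping.keys m \<Longrightarrow> c v = c' v"
    and "cring B" and "\<And>a. \<iota>' a \<in> carrier B" and "\<And>v. c' v \<in> carrier B"
  shows "poly_eval B \<iota> c p = poly_eval B \<iota>' c' p"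
proof -
  interpret B: cring B by fact
  have "monom_eval B c m = monom_eval B c' m" if "m \<in> Poly_Mapping.keys p" for m
    unfolding monom_eval_def by (rule B.finprod_cong') (use assms that in auto)
  then show ?thesis
    unfolding poly_eval_def
    by (intro B.finsum_cong') (use assms in \<open>auto simp: monom_eval_def intro!: B.m_closed B.finprod_closed\<close>)
qed

locale poly_evaluation = B: cring B
  for B :: "('b, 'n) ring_scheme" (structure) +
  fixes \<iota> :: "'a::comm_ring_1 \<Rightarrow> 'b" and c :: "'v \<Rightarrow> 'b"
  assumes coeff_hom: "\<iota> \<in> ring_hom ring_of_type_algebra B"
    and var_closed [simp]: "c v \<in> carrier B"
begin

lemma coeff_closed [simp]: "\<iota> a \<in> carrier B"
  using coeff_hom by (auto simp: ring_hom_def)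

lemma coeff_add: "\<iota> (a + b) = \<iota> a \<oplus> \<iota> b"
  and coeff_mult: "\<iota> (a * b) = \<iota> a \<otimes> \<iota> b"
  and coeff_one [simp]: "\<iota> 1 = \<one>"
  using coeff_hom by (auto simp: ring_hom_def)

lemma coeff_zero [simp]: "\<iota> 0 = \<zero>"
  using coeff_add[of 0 0] by simp

lemma monom_eval_closed [simp]: "monom_eval B c m \<in> carrier B"
  by (auto simp: monom_eval_def intro!: B.finprod_closed)

text \<open>Exponents 0 contribute factors \<open>\<one>\<close>. This allows the products for
  \<open>m\<close>, \<open>n\<close> and \<open>m + n\<close> to run over one common index
  set.\<close>

lemma monom_eval_superset:
  assumes "finite A" "Poly_Mapping.keys m \<subseteq> A"
  shows "monom_eval B c m = (\<Otimes>v\<in>A. c v [^] Poly_Mapping.lookup m v)"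
  unfolding monom_eval_def
  by (rule B.finprod_mono_neutral_cong_left) (use assms in \<open>auto simp: in_keys_iff\<close>)

lemma monom_eval_add: "monom_eval B c (m + n) = monom_eval B c m \<otimes> monom_eval B c n"
proof -
  let ?A = "Poly_Mapping.keys m \<union> Poly_Mapping.keys n"
  have "monom_eval B c (m + n) = (\<Otimes>v\<in>?A. c v [^] Poly_Mapping.lookup (m + n) v)"
    by (rule monom_eval_superset) (simp_all add: Poly_Mapping.keys_add)
  also have "\<dots> = (\<Otimes>v\<in>?A. c v [^] Poly_Mapping.lookup m v \<otimes> c v [^] Poly_Mapping.lookup n v)"
    by (rule B.finprod_cong') (auto simp: lookup_add B.nat_pow_mult)
  also have "\<dots> = monom_eval B c m \<otimes> monom_eval B c n"
    by (subst B.finprod_multf) (auto simp: monom_eval_superset[of ?A])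
  finally show ?thesis .
qed

lemma monom_eval_zero [simp]: "monom_eval B c 0 = \<one>"
  by (simp add: monom_eval_def)

lemma monom_eval_single_one [simp]: "monom_eval B c (Poly_Mapping.single v (Suc 0)) = c v"
proof -
  have "monom_eval B c (Poly_Mapping.single v (Suc 0)) = (\<Otimes>w\<in>{v}. c w [^] Poly_Mapping.lookup (Poly_Mapping.single v (Suc 0)) w)"
    by (rule monom_eval_superset) auto
  then show ?thesis by simp
qed

lemma eval_closed [simp]: "poly_eval B \<iota> c p \<in> carrier B"
  by (auto simp: poly_eval_def intro!: B.finsum_closed)

lemma eval_superset:
  assumes "finite A" "Poly_Mapping.keys p \<subseteq> A"
  shows "poly_eval B \<iota> c p = (\<Oplus>m\<in>A. \<iota> (Poly_Mapping.lookup p m) \<otimes> monom_eval B c m)"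
  unfolding poly_eval_def
  by (rule B.add.finprod_mono_neutral_cong_left) (use assms in \<open>auto simp: in_keys_iff\<close>)

lemma eval_add: "poly_eval B \<iota> c (p + q) = poly_eval B \<iota> c p \<oplus> poly_eval B \<iota> c q"
proof -
  let ?A = "Poly_Mapping.keys p \<union> Poly_Mapping.keys q"
  let ?g = "\<lambda>p m. \<iota> (Poly_Mapping.lookup p m) \<otimes> monom_eval B c m"
  have "poly_eval B \<iota> c (p + q) = (\<Oplus>m\<in>?A. ?g (p + q) m)"
    by (rule eval_superset) (simp_all add: Poly_Mapping.keys_add)
  also have "\<dots> = (\<Oplus>m\<in>?A. ?g p m \<oplus> ?g q m)"
    by (rule B.finsum_cong') (auto simp: lookup_add coeff_add B.l_distr)
  also have "\<dots> = poly_eval B \<iota> c p \<oplus> poly_eval B \<iota> c q"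
    by (subst B.finsum_addf) (auto simp: eval_superset[of ?A])
  finally show ?thesis .
qed

lemma eval_zero [simp]: "poly_eval B \<iota> c 0 = \<zero>"
  by (simp add: poly_eval_def)

lemma eval_single: "poly_eval B \<iota> c (Poly_Mapping.single m a) = \<iota> a \<otimes> monom_eval B c m"
proof -
  have "poly_eval B \<iota> c (Poly_Mapping.single m a)
      = (\<Oplus>n\<in>{m}. \<iota> (Poly_Mapping.lookup (Poly_Mapping.single m a) n) \<otimes> monom_eval B c n)"
    by (rule eval_superset) auto
  then show ?thesis by simp
qed

lemma eval_const [simp]: "poly_eval B \<iota> c (pconst a) = \<iota> a"
  by (simp add: eval_single)

lemma eval_var [simp]: "poly_eval B \<iota> c (pvar v) = c v"
  by (simp add: eval_single)

lemma eval_one [simp]: "poly_eval B \<iota> c 1 = \<one>"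
  using eval_const[of 1] by simp

text \<open>By distributivity it suffices to multiply two single terms, where
  \<open>monom_eval_add\<close> applies; hence an induction on \<open>q\<close> nested in one on
  \<open>p\<close>.\<close>

lemma eval_mult: "poly_eval B \<iota> c (p * q) = poly_eval B \<iota> c p \<otimes> poly_eval B \<iota> c q"
proof (induction p rule: poly_mapping_single_induct)
  case (add p m a)
  have "poly_eval B \<iota> c (Poly_Mapping.single m a * q)
      = poly_eval B \<iota> c (Poly_Mapping.single m a) \<otimes> poly_eval B \<iota> c q"
  proof (induction q rule: poly_mapping_single_induct)
    case (add q n b)
    then show ?case
      by (simp add: distrib_left eval_add mult_single eval_single coeff_mult monom_eval_add
          B.r_distr B.m_ac)
  qed simp
  with add show ?case
    by (simp add: distrib_right eval_add B.l_distr)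
qed simp

lemma eval_hom: "poly_eval B \<iota> c \<in> ring_hom ring_of_type_algebra B"
  by (rule ring_hom_memI) (auto simp: eval_add eval_mult)

end

text \<open>A homomorphism passes through the finite sums and products of a substitution. Taking
  \<open>h\<close> to be a substitution itself fuses two substitutions into one.\<close>

lemma hom_poly_eval:
  assumes "poly_evaluation B \<iota> c" and "cring B'" and "h \<in> ring_hom B B'"
  shows "h (poly_eval B \<iota> c p) = poly_eval B' (\<lambda>a. h (\<iota> a)) (\<lambda>v. h (c v)) p"
proof -
  interpret poly_evaluation B \<iota> c by fact
  interpret B': cring B' by fact
  interpret h: ring_hom_cring B B' h
    by unfold_locales (use assms in auto)
  have [simp]: "h (monom_eval B c m) = monom_eval B' (\<lambda>v. h (c v)) m" for m
    unfolding monom_eval_def by (subst h.hom_finprod) (auto intro!: B'.finprod_cong')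
  interpret E: poly_evaluation B' "\<lambda>a. h (\<iota> a)" "\<lambda>v. h (c v)"
    by unfold_locales (auto simp: ring_hom_def coeff_add coeff_mult)
  show ?thesis
    unfolding poly_eval_def by (subst h.hom_finsum) (auto intro!: B'.finsum_cong')
qed

section \<open>Substitution into polynomial rings, and the group action as a substitution\<close>

lemma poly_evaluation_type:
  assumes "\<iota> \<in> ring_hom ring_of_type_algebra (ring_of_type_algebra :: 'b::comm_ring_1 ring)"
  shows "poly_evaluation (ring_of_type_algebra :: 'b ring) \<iota> c"
proof -
  interpret cring "ring_of_type_algebra :: 'b ring" by (rule cring_from_type_algebra)
  show ?thesis by unfold_locales (use assms in auto)
qed

lemma pconst_hom: "pconst \<in> ring_hom ring_of_type_algebra ring_of_type_algebra"
  by (auto simp: type_ring_hom_iff single_add mult_single)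

lemma type_ring_pow [simp]: "x [^]\<^bsub>ring_of_type_algebra\<^esub> (k::nat) = (x :: 'a::comm_ring_1) ^ k"
proof -
  interpret cring "ring_of_type_algebra :: 'a ring" by (rule cring_from_type_algebra)
  show ?thesis by (induction k) (simp_all add: power_commutes)
qed

lemma type_ring_finprod [simp]:
  "finprod (ring_of_type_algebra :: 'a::comm_ring_1 ring) g A = prod g A"
proof -
  interpret cring "ring_of_type_algebra :: 'a ring" by (rule cring_from_type_algebra)
  show ?thesis by (induction A rule: infinite_finite_induct) auto
qed

lemma type_ring_finsum [simp]:
  "finsum (ring_of_type_algebra :: 'a::comm_ring_1 ring) g A = sum g A"
proof -
  interpret cring "ring_of_type_algebra :: 'a ring" by (rule cring_from_type_algebra)
  show ?thesis by (induction A rule: infinite_finite_induct) auto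
qed

lemma single_add_monom:
  "Poly_Mapping.single (m + n) (1::'a::comm_ring_1) = Poly_Mapping.single m 1 * Poly_Mapping.single n 1"
  by (simp add: mult_single)

lemma single_sum_monom:
  "Poly_Mapping.single (\<Sum>v\<in>A. g v) (1::'a::comm_ring_1) = (\<Prod>v\<in>A. Poly_Mapping.single (g v) 1)"
  by (induction A rule: infinite_finite_induct) (auto simp: single_add_monom)

lemma single_var_power:
  "(pvar v :: _ \<Rightarrow>\<^sub>0 'a::comm_ring_1) ^ k = Poly_Mapping.single (Poly_Mapping.single v k) 1"
proof (induction k)
  case (Suc k)
  have "Poly_Mapping.single v (Suc k) = Poly_Mapping.single v (Suc 0) + Poly_Mapping.single v k"
    by (simp add: single_add[symmetric])
  then have "Poly_Mapping.single (Poly_Mapping.single v (Suc k)) (1::'a) = pvar v * pvar v ^ k"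
    using Suc by (simp only: single_add_monom)
  then show ?case by simp
qed simp

text \<open>Together with \<open>hom_poly_eval\<close> this expresses that a homomorphism on
  polynomials is determined by its values on constants and variables.\<close>

lemma poly_eval_var:
  "poly_eval ring_of_type_algebra pconst pvar p = (p :: ('v \<Rightarrow>\<^sub>0 nat) \<Rightarrow>\<^sub>0 'a::comm_ring_1)"
proof -
  interpret poly_evaluation ring_of_type_algebra "pconst :: 'a \<Rightarrow> _" "pvar :: 'v \<Rightarrow> _"
    by (rule poly_evaluation_type[OF pconst_hom])
  have "monom_eval ring_of_type_algebra pvar m = Poly_Mapping.single m (1::'a)" for m :: "'v \<Rightarrow>\<^sub>0 nat"
  proof (induction m rule: poly_mapping_single_induct)
    case (add m v k)
    have "monom_eval ring_of_type_algebra pvar (Poly_Mapping.single v k)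
        = Poly_Mapping.single (Poly_Mapping.single v k) (1::'a)"
      unfolding monom_eval_def type_ring_pow single_var_power by simp
    with add show ?case by (simp only: monom_eval_add single_add_monom type_ring_simps)
  qed (simp add: monom_eval_def)
  then show ?thesis
    by (induction p rule: poly_mapping_single_induct) (simp_all add: eval_add eval_single mult_single)
qed

text \<open>A sum of exponent vectors corresponds to a product of powers of variables, so
  \<open>dmonom_act\<close> is the substitution of translated variables. The action thereby inherits
  everything proved for \<open>poly_evaluation\<close>.\<close>

lemma dpoly_act_eq_poly_eval:
  fixes act :: "'g::group_add \<Rightarrow> 'a \<Rightarrow> 'a::field"
  shows "(dpoly_act act \<sigma> :: ('g, 'y, 'a) dpoly \<Rightarrow> _) =
     poly_eval ring_of_type_algebra (\<lambda>a. pconst (act \<sigma> a)) (\<lambda>v. pvar (\<sigma> + fst v, snd v))"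
proof (rule ext)
  fix p :: "('g, 'y, 'a) dpoly"
  have "monom_eval ring_of_type_algebra (\<lambda>v. pvar (\<sigma> + fst v, snd v)) m
      = Poly_Mapping.single (dmonom_act \<sigma> m) (1::'a)" for m :: "('g, 'y) dmonom"
    unfolding monom_eval_def type_ring_pow single_var_power dmonom_act_def case_prod_unfold
    by (simp add: single_sum_monom)
  then show "dpoly_act act \<sigma> p = poly_eval ring_of_type_algebra (\<lambda>a. pconst (act \<sigma> a)) (\<lambda>v. pvar (\<sigma> + fst v, snd v)) p"
    by (simp add: dpoly_act_def poly_eval_def mult_single)
qed

section \<open>Localization of a quotient ring\<close>

text \<open>\<open>T\<close> is an ideal (negatives come from the multiplier \<open>-1\<close>) and
  \<open>S\<close> a multiplicative set. Quotient and localization are formed in a single step,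
  giving the ring of fractions of R/T with denominators in \<open>S\<close>.\<close>

locale localized_quotient =
  fixes S T :: "'r::comm_ring_1 set"
  assumes one_S [simp]: "1 \<in> S" and mult_S [simp]: "s \<in> S \<Longrightarrow> t \<in> S \<Longrightarrow> s * t \<in> S"
    and zero_T [simp]: "0 \<in> T" and add_T: "x \<in> T \<Longrightarrow> y \<in> T \<Longrightarrow> x + y \<in> T"
    and mult_T: "x \<in> T \<Longrightarrow> r * x \<in> T"
begin

text \<open>Equality of h/s and h'/s' after localizing R/T. The factor \<open>u\<close> accounts for
  elements of \<open>S\<close> that are zero divisors modulo \<open>T\<close>.\<close>

definition frac_rel :: "(('r \<times> 'r) \<times> ('r \<times> 'r)) set" where
  "frac_rel = {((h, s), (h', s')). s \<in> S \<and> s' \<in> S \<and> (\<exists>u\<in>S. u * (h * s' - h' * s) \<in> T)}"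

definition fraction :: "'r \<Rightarrow> 'r \<Rightarrow> ('r \<times> 'r) set" where
  "fraction h s = frac_rel `` {(h, s)}"

text \<open>The ring operations and \<open>frac_map\<close> work on chosen representatives;
  \<open>frac_mult\<close>, \<open>frac_add\<close> and \<open>frac_map_fraction\<close> show that
  the choice is immaterial.\<close>

definition numer :: "('r \<times> 'r) set \<Rightarrow> 'r" where
  "numer V = fst (SOME x. x \<in> V)"

definition denom :: "('r \<times> 'r) set \<Rightarrow> 'r" where
  "denom V = snd (SOME x. x \<in> V)"

definition frac_ring :: "('r \<times> 'r) set ring" where
  "frac_ring =
     \<lparr>carrier = {fraction h s |h s. s \<in> S},
      monoid.mult = (\<lambda>V W. fraction (numer V * numer W) (denom V * denom W)),
      one = fraction 1 1,
      ring.zero = fraction 0 1,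
      add = (\<lambda>V W. fraction (numer V * denom W + numer W * denom V) (denom V * denom W))\<rparr>"

definition frac_map :: "('r \<Rightarrow> 'r) \<Rightarrow> ('r \<times> 'r) set \<Rightarrow> ('r \<times> 'r) set" where
  "frac_map g V = fraction (g (numer V)) (g (denom V))"

lemma equiv_frac_rel: "equiv (UNIV \<times> S) frac_rel"
proof (rule equivI)
  show "frac_rel \<subseteq> (UNIV \<times> S) \<times> (UNIV \<times> S)"
    by (auto simp: frac_rel_def)
  show "refl_on (UNIV \<times> S) frac_rel"
    by (auto simp: frac_rel_def refl_on_def intro!: bexI[of _ 1])
  show "sym frac_rel"
  proof (rule symI, clarsimp simp: frac_rel_def)
    fix h s h' s' u
    assume "u \<in> S" "u * (h * s' - h' * s) \<in> T"
    then show "\<exists>u\<in>S. u * (h' * s - h * s') \<in> T"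
      using mult_T[of "u * (h * s' - h' * s)" "-1"] by (intro bexI[of _ u]) (simp_all add: algebra_simps)
  qed
  show "trans frac_rel"
  proof (rule transI, clarsimp simp: frac_rel_def)
    fix h s h' s' h'' s'' u v
    assume *: "s' \<in> S" "u \<in> S" "v \<in> S" "u * (h * s' - h' * s) \<in> T" "v * (h' * s'' - h'' * s') \<in> T"
    \<comment> \<open>The extra factor \<open>s'\<close> clears the middle denominator; the terms
      containing \<open>h'\<close> cancel on the right.\<close>
    have "u * v * s' * (h * s'' - h'' * s)
        = (v * s'') * (u * (h * s' - h' * s)) + (u * s) * (v * (h' * s'' - h'' * s'))"
      by (simp add: algebra_simps)
    also have "\<dots> \<in> T" using * by (simp add: add_T mult_T)
    finally show "\<exists>u\<in>S. u * (h * s'' - h'' * s) \<in> T"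
      using * by (intro bexI[of _ "u * v * s'"]) auto
  qed
qed

lemma frac_eq_iff:
  assumes "s \<in> S" "s' \<in> S"
  shows "fraction h s = fraction h' s' \<longleftrightarrow> (\<exists>u\<in>S. u * (h * s' - h' * s) \<in> T)"
  unfolding fraction_def using assms
  by (subst eq_equiv_class_iff[OF equiv_frac_rel]) (auto simp: frac_rel_def)

lemma frac_eqI: "s \<in> S \<Longrightarrow> s' \<in> S \<Longrightarrow> h * s' = h' * s \<Longrightarrow> fraction h s = fraction h' s'"
  by (auto simp: frac_eq_iff intro!: bexI[of _ 1])

lemma frac_numer_denom:
  assumes "s \<in> S"
  shows "denom (fraction h s) \<in> S" "fraction (numer (fraction h s)) (denom (fraction h s)) = fraction h s"
proof -
  have "(h, s) \<in> fraction h s"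
    using assms equiv_class_self[OF equiv_frac_rel] by (auto simp: fraction_def)
  then have "(SOME x. x \<in> fraction h s) \<in> fraction h s"
    by (rule someI)
  then have rel: "((h, s), (numer (fraction h s), denom (fraction h s))) \<in> frac_rel"
    by (simp add: fraction_def numer_def denom_def)
  then show "denom (fraction h s) \<in> S"
    by (simp add: frac_rel_def)
  show "fraction (numer (fraction h s)) (denom (fraction h s)) = fraction h s"
    using equiv_class_eq[OF equiv_frac_rel rel] by (simp add: fraction_def)
qed

lemma frac_carrier [simp]: "s \<in> S \<Longrightarrow> fraction h s \<in> carrier frac_ring"
  by (auto simp: frac_ring_def)

lemma frac_cases:
  assumes "V \<in> carrier frac_ring"
  obtains h s where "s \<in> S" "V = fraction h s"
  using assms by (auto simp: frac_ring_def)

text \<open>Independence of representatives: passing from the chosen pair of fractions to the given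
  one changes one factor at a time, so the discrepancy is a combination of the two given relations,
  witnessed by \<open>u * v\<close>. The same splitting handles \<open>frac_add\<close>.\<close>

lemma frac_mult [simp]:
  assumes "s \<in> S" "t \<in> S"
  shows "fraction h s \<otimes>\<^bsub>frac_ring\<^esub> fraction g t = fraction (h * g) (s * t)"
proof -
  define h' s' g' t' where "h' = numer (fraction h s)" "s' = denom (fraction h s)"
    "g' = numer (fraction g t)" "t' = denom (fraction g t)"
  note defs = this
  have S: "s' \<in> S" "t' \<in> S" and eq: "fraction h' s' = fraction h s" "fraction g' t' = fraction g t"
    using frac_numer_denom assms unfolding defs by auto
  from eq obtain u v where uv: "u \<in> S" "v \<in> S" "u * (h' * s - h * s') \<in> T" "v * (g' * t - g * t') \<in> T"
    using S assms by (auto simp: frac_eq_iff)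
  have "u * v * (h' * g' * (s * t) - h * g * (s' * t'))
      = (v * g' * t) * (u * (h' * s - h * s')) + (u * h * s') * (v * (g' * t - g * t'))"
    by (simp add: algebra_simps)
  also have "\<dots> \<in> T" using uv by (simp add: add_T mult_T)
  finally have "fraction (h' * g') (s' * t') = fraction (h * g) (s * t)"
    using S assms uv by (auto simp: frac_eq_iff intro!: bexI[of _ "u * v"])
  then show ?thesis by (simp add: frac_ring_def defs)
qed

lemma frac_add [simp]:
  assumes "s \<in> S" "t \<in> S"
  shows "fraction h s \<oplus>\<^bsub>frac_ring\<^esub> fraction g t = fraction (h * t + g * s) (s * t)"
proof -
  define h' s' g' t' where "h' = numer (fraction h s)" "s' = denom (fraction h s)"
    "g' = numer (fraction g t)" "t' = denom (fraction g t)"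
  note defs = this
  have S: "s' \<in> S" "t' \<in> S" and eq: "fraction h' s' = fraction h s" "fraction g' t' = fraction g t"
    using frac_numer_denom assms unfolding defs by auto
  from eq obtain u v where uv: "u \<in> S" "v \<in> S" "u * (h' * s - h * s') \<in> T" "v * (g' * t - g * t') \<in> T"
    using S assms by (auto simp: frac_eq_iff)
  have "u * v * ((h' * t' + g' * s') * (s * t) - (h * t + g * s) * (s' * t'))
      = (v * t * t') * (u * (h' * s - h * s')) + (u * s * s') * (v * (g' * t - g * t'))"
    by (simp add: algebra_simps)
  also have "\<dots> \<in> T" using uv by (simp add: add_T mult_T)
  finally have "fraction (h' * t' + g' * s') (s' * t') = fraction (h * t + g * s) (s * t)"
    using S assms uv by (auto simp: frac_eq_iff intro!: bexI[of _ "u * v"])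
  then show ?thesis by (simp add: frac_ring_def defs)
qed

lemma frac_one: "\<one>\<^bsub>frac_ring\<^esub> = fraction 1 1"
  and frac_zero: "\<zero>\<^bsub>frac_ring\<^esub> = fraction 0 1"
  by (simp_all add: frac_ring_def)

lemma cring_frac_ring: "cring frac_ring"
proof (rule cringI)
  show "abelian_group frac_ring"
  proof (rule abelian_groupI)
    fix V assume "V \<in> carrier frac_ring"
    then obtain h s where V: "s \<in> S" "V = fraction h s" by (rule frac_cases)
    then have "fraction (-h) s \<oplus>\<^bsub>frac_ring\<^esub> V = \<zero>\<^bsub>frac_ring\<^esub>"
      by (simp add: frac_zero) (rule frac_eqI, simp_all)
    with V show "\<exists>W\<in>carrier frac_ring. W \<oplus>\<^bsub>frac_ring\<^esub> V = \<zero>\<^bsub>frac_ring\<^esub>"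
      by (intro bexI[of _ "fraction (-h) s"]) auto
  qed (auto elim!: frac_cases simp: frac_zero algebra_simps)
  show "comm_monoid frac_ring"
    by (rule comm_monoidI) (auto elim!: frac_cases simp: frac_one algebra_simps)
  fix U V W assume "U \<in> carrier frac_ring" "V \<in> carrier frac_ring" "W \<in> carrier frac_ring"
  then show "(U \<oplus>\<^bsub>frac_ring\<^esub> V) \<otimes>\<^bsub>frac_ring\<^esub> W
      = U \<otimes>\<^bsub>frac_ring\<^esub> W \<oplus>\<^bsub>frac_ring\<^esub> V \<otimes>\<^bsub>frac_ring\<^esub> W"
    by (elim frac_cases) (simp, rule frac_eqI, simp_all add: algebra_simps)
qed

lemma frac_eq_zero_iff: "s \<in> S \<Longrightarrow> fraction h s = \<zero>\<^bsub>frac_ring\<^esub> \<longleftrightarrow> (\<exists>u\<in>S. u * h \<in> T)"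
  by (simp add: frac_zero frac_eq_iff)

lemma frac_hom: "(\<lambda>x. fraction x 1) \<in> ring_hom ring_of_type_algebra frac_ring"
  by (rule ring_hom_memI) (auto simp: frac_one)

context
  fixes g :: "'r \<Rightarrow> 'r"
  assumes g_hom: "g \<in> ring_hom ring_of_type_algebra ring_of_type_algebra"
    and g_S: "g ` S \<subseteq> S" and g_T: "g ` T \<subseteq> T"
begin

text \<open>The image under \<open>g\<close> of a witness \<open>u\<close> for equality of two
  representatives is a witness for their images, since \<open>g\<close> preserves both
  \<open>S\<close> and \<open>T\<close>.\<close>

lemma frac_map_fraction:
  assumes "s \<in> S"
  shows "frac_map g (fraction h s) = fraction (g h) (g s)"
proof -
  let ?h = "numer (fraction h s)" and ?s = "denom (fraction h s)"
  have add: "\<And>x y. g (x + y) = g x + g y" and mult: "\<And>x y. g (x * y) = g x * g y"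
    using g_hom by (auto simp: type_ring_hom_iff)
  have diff: "g (x - y) = g x - g y" for x y
    using add[of "x - y" y] by simp
  have S: "?s \<in> S" "fraction ?h ?s = fraction h s"
    using frac_numer_denom[OF assms] by auto
  then obtain u where "u \<in> S" "u * (?h * s - h * ?s) \<in> T"
    using assms by (auto simp: frac_eq_iff)
  then have "g u \<in> S" "g u * (g ?h * g s - g h * g ?s) \<in> T"
    using g_S g_T by (auto simp flip: mult diff)
  moreover have "g s \<in> S" "g ?s \<in> S" using assms S g_S by auto
  ultimately show ?thesis
    unfolding frac_map_def by (subst frac_eq_iff) auto
qed

lemma frac_map_hom: "frac_map g \<in> ring_hom frac_ring frac_ring"
proof (rule ring_hom_memI)
  have g: "g (x + y) = g x + g y" "g (x * y) = g x * g y" "g 1 = 1" for x y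
    using g_hom by (auto simp: type_ring_hom_iff)
  have [simp]: "s \<in> S \<Longrightarrow> g s \<in> S" for s using g_S by auto
  show "frac_map g \<one>\<^bsub>frac_ring\<^esub> = \<one>\<^bsub>frac_ring\<^esub>"
    by (simp add: frac_one frac_map_fraction g)
  fix V W assume "V \<in> carrier frac_ring" "W \<in> carrier frac_ring"
  then show "frac_map g V \<in> carrier frac_ring"
    "frac_map g (V \<otimes>\<^bsub>frac_ring\<^esub> W) = frac_map g V \<otimes>\<^bsub>frac_ring\<^esub> frac_map g W"
    "frac_map g (V \<oplus>\<^bsub>frac_ring\<^esub> W) = frac_map g V \<oplus>\<^bsub>frac_ring\<^esub> frac_map g W"
    by (auto elim!: frac_cases simp: frac_map_fraction g)
qed

end

end

section \<open>Perfect difference ideals\<close>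

lemma dpoly_ring_closed [simp]:
  "0 \<in> carrier (dpoly_ring Y)" "1 \<in> carrier (dpoly_ring Y)" "pconst a \<in> carrier (dpoly_ring Y)"
  by (auto simp: carrier_dpoly_ring)

lemma pvar_in_dpoly_ring: "snd v \<in> Y \<Longrightarrow> pvar v \<in> carrier (dpoly_ring Y)"
  by (cases v) (auto simp: carrier_dpoly_ring)

lemma add_in_dpoly_ring:
  "p \<in> carrier (dpoly_ring Y) \<Longrightarrow> q \<in> carrier (dpoly_ring Y) \<Longrightarrow> p + q \<in> carrier (dpoly_ring Y)"
  using Poly_Mapping.keys_add[of p q] unfolding carrier_dpoly_ring by blast

lemma uminus_in_dpoly_ring: "p \<in> carrier (dpoly_ring Y) \<Longrightarrow> - p \<in> carrier (dpoly_ring Y)"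
  by (simp add: carrier_dpoly_ring)

lemma mult_in_dpoly_ring:
  assumes "p \<in> carrier (dpoly_ring Y)" "q \<in> carrier (dpoly_ring Y)"
  shows "p * q \<in> carrier (dpoly_ring Y)"
  unfolding carrier_dpoly_ring
proof
  fix m assume "m \<in> Poly_Mapping.keys (p * q)"
  then obtain m1 m2 where "m = m1 + m2" "m1 \<in> Poly_Mapping.keys p" "m2 \<in> Poly_Mapping.keys q"
    using Poly_Mapping.keys_mult[of p q] by blast
  then show "Poly_Mapping.keys m \<subseteq> UNIV \<times> Y"
    using assms Poly_Mapping.keys_add[of m1 m2] unfolding carrier_dpoly_ring by blast
qed

lemma cring_dpoly_ring: "cring (dpoly_ring Y :: ('g, 'y, 'a::field) dpoly ring)" (is "cring ?R")
proof (rule cringI)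
  show "abelian_group ?R"
  proof (rule abelian_groupI)
    fix p :: "('g, 'y, 'a) dpoly" assume "p \<in> carrier ?R"
    then show "\<exists>q\<in>carrier ?R. q \<oplus>\<^bsub>?R\<^esub> p = \<zero>\<^bsub>?R\<^esub>"
      by (intro bexI[of _ "- p"]) (auto simp: uminus_in_dpoly_ring)
  qed (auto simp: add_in_dpoly_ring algebra_simps)
  show "comm_monoid ?R"
    by (rule comm_monoidI) (auto simp: mult_in_dpoly_ring algebra_simps)
qed (auto simp: algebra_simps)

lemma pow_in_dpoly_ring: "p \<in> carrier (dpoly_ring Y) \<Longrightarrow> p ^ k \<in> carrier (dpoly_ring Y)"
  by (induction k) (auto simp: mult_in_dpoly_ring)

lemma sum_in_dpoly_ring:
  "(\<And>i. i \<in> A \<Longrightarrow> g i \<in> carrier (dpoly_ring Y)) \<Longrightarrow> sum g A \<in> carrier (dpoly_ring Y)"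
  by (induction A rule: infinite_finite_induct) (auto simp: add_in_dpoly_ring)

lemma prod_in_dpoly_ring:
  "(\<And>i. i \<in> A \<Longrightarrow> g i \<in> carrier (dpoly_ring Y)) \<Longrightarrow> prod g A \<in> carrier (dpoly_ring Y)"
  by (induction A rule: infinite_finite_induct) (auto simp: mult_in_dpoly_ring)

lemma dpoly_ring_pow [simp]: "p [^]\<^bsub>dpoly_ring Y\<^esub> (k::nat) = p ^ k"
proof -
  interpret cring "dpoly_ring Y" by (rule cring_dpoly_ring)
  show ?thesis by (induction k) (simp_all add: power_commutes)
qed

lemma dpoly_ring_finprod:
  "(\<And>i. i \<in> A \<Longrightarrow> g i \<in> carrier (dpoly_ring Y)) \<Longrightarrow> finprod (dpoly_ring Y) g A = prod g A"
proof -
  interpret cring "dpoly_ring Y" by (rule cring_dpoly_ring)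
  show "(\<And>i. i \<in> A \<Longrightarrow> g i \<in> carrier (dpoly_ring Y)) \<Longrightarrow> finprod (dpoly_ring Y) g A = prod g A"
    by (induction A rule: infinite_finite_induct) (auto simp: Pi_iff)
qed

lemma poly_eval_in_dpoly_ring:
  assumes "\<And>a. \<iota> a \<in> carrier (dpoly_ring Y)"
    and "\<And>m v. m \<in> Poly_Mapping.keys p \<Longrightarrow> v \<in> Poly_Mapping.keys m \<Longrightarrow> c v \<in> carrier (dpoly_ring Y)"
  shows "poly_eval ring_of_type_algebra \<iota> c p \<in> carrier (dpoly_ring Y)"
  using assms
  by (auto simp: poly_eval_def monom_eval_def
      intro!: sum_in_dpoly_ring mult_in_dpoly_ring prod_in_dpoly_ring pow_in_dpoly_ring)

lemma dpoly_ring_keysD: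
  "p \<in> carrier (dpoly_ring Y) \<Longrightarrow> m \<in> Poly_Mapping.keys p \<Longrightarrow> v \<in> Poly_Mapping.keys m \<Longrightarrow> snd v \<in> Y"
  unfolding carrier_dpoly_ring by fastforce

text \<open>A difference ideal is perfect iff it contains every element whose orbit monoid it meets.\<close>

inductive_set orbit_monoid :: "('g \<Rightarrow> 'r \<Rightarrow> 'r::comm_ring_1) \<Rightarrow> 'r \<Rightarrow> 'r set"
  for D :: "'g \<Rightarrow> 'r \<Rightarrow> 'r" and a :: 'r where
  one: "1 \<in> orbit_monoid D a"
| step: "x \<in> orbit_monoid D a \<Longrightarrow> D \<sigma> a * x \<in> orbit_monoid D a"

lemma orbit_monoid_mult:
  "x \<in> orbit_monoid D a \<Longrightarrow> y \<in> orbit_monoid D a \<Longrightarrow> x * y \<in> orbit_monoid D a"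
  by (induction rule: orbit_monoid.induct) (auto simp: mult.assoc intro: orbit_monoid.step)

lemma orbit_monoid_conjugate: "D \<sigma> a \<in> orbit_monoid D a"
  using orbit_monoid.step[OF orbit_monoid.one] by simp

lemma orbit_monoid_power: "x \<in> orbit_monoid D a \<Longrightarrow> x ^ k \<in> orbit_monoid D a"
  by (induction k) (auto intro: orbit_monoid.one orbit_monoid_mult)

lemma orbit_monoid_prod:
  "(\<And>i. i \<in> A \<Longrightarrow> g i \<in> orbit_monoid D a) \<Longrightarrow> prod g A \<in> orbit_monoid D a"
  by (induction A rule: infinite_finite_induct) (auto intro: orbit_monoid.one orbit_monoid_mult)

text \<open>Powers are written as repeated conjugates, so no exponents appear; \<open>r = 0\<close>
  stands for the element \<open>1\<close>.\<close>

lemma orbit_monoid_as_prod: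
  "x \<in> orbit_monoid D a \<Longrightarrow> \<exists>(r::nat) \<tau>. x = (\<Prod>i\<in>{1..r}. D (\<tau> i) a)"
proof (induction rule: orbit_monoid.induct)
  case one
  show ?case by (rule exI[of _ 0]) simp
next
  case (step x \<sigma>)
  then obtain r :: nat and \<tau> where x: "x = (\<Prod>i\<in>{1..r}. D (\<tau> i) a)" by blast
  have "(\<Prod>i\<in>{1..Suc r}. D ((\<tau>(Suc r := \<sigma>)) i) a) = (\<Prod>i\<in>{1..r}. D (\<tau> i) a) * D \<sigma> a"
    by (simp add: prod.nat_ivl_Suc' mult.commute)
  then show ?case
    unfolding x by (intro exI[of _ "Suc r"] exI[of _ "\<tau>(Suc r := \<sigma>)"]) (simp add: mult.commute)
qed

lemma orbit_monoid_image:
  assumes "\<And>x y. h (x * y) = h x * h y" "h 1 = 1" "\<And>\<sigma>. h (D \<sigma> a) \<in> orbit_monoid D' b"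
  shows "x \<in> orbit_monoid D a \<Longrightarrow> h x \<in> orbit_monoid D' b"
  by (induction rule: orbit_monoid.induct) (auto simp: assms intro: orbit_monoid.one orbit_monoid_mult)

text \<open>A perfect difference ideal \<open>T\<close> of a ring filling a whole type, with
  perfectness stated through orbit monoids, and an element \<open>f\<close> outside it. The
  denominators of the localization are the products of conjugates of \<open>f\<close>.\<close>

locale perfect_ideal_complement =
  fixes D :: "'g::group_add \<Rightarrow> 'r \<Rightarrow> 'r::comm_ring_1" and T :: "'r set" and f :: 'r
  assumes D_hom: "D \<sigma> \<in> ring_hom ring_of_type_algebra ring_of_type_algebra"
    and D_add: "D (\<sigma> + \<tau>) x = D \<sigma> (D \<tau> x)" and D_zero: "D 0 x = x"
    and T_zero: "0 \<in> T" and T_add: "x \<in> T \<Longrightarrow> y \<in> T \<Longrightarrow> x + y \<in> T"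
    and T_mult: "x \<in> T \<Longrightarrow> r * x \<in> T"
    and T_stable: "D \<sigma> ` T \<subseteq> T"
    and T_perfect: "x \<in> orbit_monoid D a \<Longrightarrow> x \<in> T \<Longrightarrow> a \<in> T"
    and f_notin: "f \<notin> T"
begin

lemma D_mult: "D \<sigma> (x * y) = D \<sigma> x * D \<sigma> y" and D_one: "D \<sigma> 1 = 1"
  using D_hom by (auto simp: type_ring_hom_iff)

sublocale localized_quotient "orbit_monoid D f" T
  by unfold_locales (auto intro: orbit_monoid.one orbit_monoid_mult T_zero T_add T_mult)

lemma orbit_monoid_stable: "D \<sigma> ` orbit_monoid D a \<subseteq> orbit_monoid D a"
  using orbit_monoid_image[of "D \<sigma>" D a D a] D_mult D_one
  by (auto simp flip: D_add intro: orbit_monoid_conjugate)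

lemmas frac_map_D_fraction = frac_map_fraction[OF D_hom orbit_monoid_stable T_stable]
  and frac_map_D_hom = frac_map_hom[OF D_hom orbit_monoid_stable T_stable]

lemma conjugate_f [simp]: "D \<sigma> f \<in> orbit_monoid D f" "f \<in> orbit_monoid D f"
  using orbit_monoid_conjugate[of D \<sigma> f] orbit_monoid_conjugate[of D 0 f] by (auto simp: D_zero)

text \<open>If 1 = 0, some product of conjugates of \<open>f\<close> lies in \<open>T\<close>, and
  perfectness puts \<open>f\<close> itself there.\<close>

lemma frac_ring_one_neq_zero: "\<one>\<^bsub>frac_ring\<^esub> \<noteq> \<zero>\<^bsub>frac_ring\<^esub>"
  using T_perfect f_notin by (auto simp: frac_one frac_eq_zero_iff)

text \<open>Pad each conjugate of \<open>a\<close> with the conjugate of \<open>b\<close> by the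
  same group element, and vice versa. This lets perfectness be applied to \<open>a * b\<close> when
  only a mixed product of conjugates is known to lie in \<open>T\<close>.\<close>

lemma orbit_monoid_dvd:
  assumes "x \<in> orbit_monoid D a" "y \<in> orbit_monoid D b"
  shows "\<exists>z\<in>orbit_monoid D (a * b). x * y dvd z"
  using assms(1)
proof induction
  case one
  from assms(2) show ?case
  proof induction
    case one
    then show ?case by (auto intro: orbit_monoid.one)
  next
    case (step y \<sigma>)
    then obtain z where "z \<in> orbit_monoid D (a * b)" "y dvd z" by auto
    then show ?case
      by (intro bexI[of _ "D \<sigma> (a * b) * z"] orbit_monoid.step) (auto simp: D_mult intro: mult_dvd_mono)
  qed
next
  case (step x \<sigma>)
  then obtain z where "z \<in> orbit_monoid D (a * b)" "x * y dvd z" by auto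
  then show ?case
    by (intro bexI[of _ "D \<sigma> (a * b) * z"] orbit_monoid.step)
       (auto simp: D_mult mult.assoc intro: mult_dvd_mono dvd_mult)
qed

text \<open>Write \<open>\<phi> q\<close> as h/s. If a product of conjugates of h/s vanishes, then
  \<open>u * h'\<close> lies in \<open>T\<close> for products \<open>u\<close> and \<open>h'\<close>
  of conjugates of \<open>f\<close> and \<open>h\<close>. Padding and perfectness give
  \<open>f * h \<in> T\<close>, and \<open>f\<close> is a unit in the localization, so h/s =
  0.\<close>

lemma kernel_perfect:
  fixes DA :: "'g \<Rightarrow> 'q \<Rightarrow> 'q::comm_ring_1"
  assumes \<phi>: "\<phi> \<in> ring_hom ring_of_type_algebra frac_ring"
    and \<phi>_D: "\<And>\<sigma> q. \<phi> (DA \<sigma> q) = frac_map (D \<sigma>) (\<phi> q)"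
    and x: "x \<in> orbit_monoid DA q" "\<phi> x = \<zero>\<^bsub>frac_ring\<^esub>"
  shows "\<phi> q = \<zero>\<^bsub>frac_ring\<^esub>"
proof -
  have "\<phi> q \<in> carrier frac_ring"
    using \<phi> by (auto simp: ring_hom_def)
  then obtain h s where s: "s \<in> orbit_monoid D f" and q: "\<phi> q = fraction h s"
    by (rule frac_cases)
  \<comment> \<open>The numerator follows the construction of \<open>x\<close> with \<open>h\<close>
    in place of \<open>q\<close>; the denominator stays in the orbit monoid of \<open>f\<close>,
    which is stable under the action.\<close>
  have "\<exists>h'\<in>orbit_monoid D h. \<exists>s'\<in>orbit_monoid D f. \<phi> x = fraction h' s'"
    using x(1)
  proof induction
    case one
    have "\<phi> 1 = fraction 1 1" using \<phi> by (auto simp: ring_hom_def frac_one)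
    then show ?case by (intro bexI[of _ 1]) (auto intro: orbit_monoid.one)
  next
    case (step x \<sigma>)
    then obtain h' s' where IH: "h' \<in> orbit_monoid D h" "s' \<in> orbit_monoid D f" "\<phi> x = fraction h' s'"
      by blast
    have Ds: "D \<sigma> s \<in> orbit_monoid D f" using s orbit_monoid_stable by blast
    have "\<phi> (DA \<sigma> q * x) = \<phi> (DA \<sigma> q) \<otimes>\<^bsub>frac_ring\<^esub> \<phi> x"
      using \<phi> by (auto simp: ring_hom_def)
    also have "\<dots> = fraction (D \<sigma> h * h') (D \<sigma> s * s')"
      using IH s Ds by (simp add: \<phi>_D q frac_map_D_fraction)
    finally show ?case
      using IH Ds by (intro bexI[of _ "D \<sigma> h * h'"] bexI[of _ "D \<sigma> s * s'"]) (auto intro: orbit_monoid.step)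
  qed
  then obtain h' s' where h': "h' \<in> orbit_monoid D h" "s' \<in> orbit_monoid D f" "\<phi> x = fraction h' s'"
    by blast
  then have "fraction h' s' = \<zero>\<^bsub>frac_ring\<^esub>" using x(2) by simp
  then obtain u where u: "u \<in> orbit_monoid D f" "u * h' \<in> T"
    using h'(2) by (auto simp only: frac_eq_zero_iff)
  obtain z where z: "z \<in> orbit_monoid D (f * h)" "u * h' dvd z"
    using orbit_monoid_dvd u(1) h'(1) by blast
  then obtain k where "z = k * (u * h')"
    by (metis dvdE mult.commute)
  then have "f * h \<in> T"
    using z(1) T_perfect T_mult[OF u(2)] by blast
  then show ?thesis
    using s by (auto simp: q frac_eq_zero_iff intro!: bexI[of _ f])
qed

end

section \<open>Perfectness by orbit monoids compared with the definition\<close>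

lemma perfect_difference_ideal_orbitD:
  assumes "perfect_difference_ideal D \<tt> (dpoly_ring Y)"
    and D_closed: "\<And>\<sigma>. D \<sigma> a \<in> carrier (dpoly_ring Y)"
    and a: "a \<in> carrier (dpoly_ring Y)" and x: "x \<in> orbit_monoid D a" "x \<in> \<tt>"
  shows "a \<in> \<tt>"
proof -
  have I: "ideal \<tt> (dpoly_ring Y)"
    using assms by (auto simp: perfect_difference_ideal_def difference_ideal_def)
  obtain r :: nat and \<tau> where r: "x = (\<Prod>i\<in>{1..r}. D (\<tau> i) a)"
    using orbit_monoid_as_prod[OF x(1)] by blast
  show ?thesis
  proof (cases "r = 0")
    \<comment> \<open>Here \<open>x = 1\<close>, so \<open>\<tt>\<close> is the whole ring. The
      definition of perfectness speaks only of products with at least one factor, hence the separate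
      case.\<close>
    case True
    then show ?thesis
      using ideal.I_r_closed[OF I x(2) a] r by simp
  next
    case False
    have "(\<Otimes>\<^bsub>dpoly_ring Y\<^esub>i\<in>{1..r}. D (\<tau> i) a [^]\<^bsub>dpoly_ring Y\<^esub> (1::nat)) = x"
      unfolding r dpoly_ring_pow by (subst dpoly_ring_finprod) (auto simp: D_closed)
    then have prod: "(\<Otimes>\<^bsub>dpoly_ring Y\<^esub>i\<in>{1..r}. D (\<tau> i) a [^]\<^bsub>dpoly_ring Y\<^esub> (1::nat)) \<in> \<tt>"
      using x(2) by simp
    have "r \<ge> 1" using False by simp
    from bspec[OF conjunct2[OF assms(1)[unfolded perfect_difference_ideal_def]] a, rule_format,
        OF this, where k = "\<lambda>_. 1", OF _ prod]
    show ?thesis by simp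
  qed
qed

lemma perfect_difference_idealI:
  assumes "difference_ideal D \<aa> (dpoly_ring Y)"
    and D_closed: "\<And>\<sigma> a. a \<in> carrier (dpoly_ring Y) \<Longrightarrow> D \<sigma> a \<in> carrier (dpoly_ring Y)"
    and orbit: "\<And>a x. a \<in> carrier (dpoly_ring Y) \<Longrightarrow> x \<in> orbit_monoid D a \<Longrightarrow> x \<in> \<aa> \<Longrightarrow> a \<in> \<aa>"
  shows "perfect_difference_ideal D \<aa> (dpoly_ring Y)"
  unfolding perfect_difference_ideal_def
proof (intro conjI ballI allI impI)
  show "difference_ideal D \<aa> (dpoly_ring Y)" by fact
  fix a :: "('b, 'c, 'd) dpoly" and r :: nat and \<tau> :: "nat \<Rightarrow> 'a" and k :: "nat \<Rightarrow> nat"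
  assume a: "a \<in> carrier (dpoly_ring Y)"
    and "(\<Otimes>\<^bsub>dpoly_ring Y\<^esub>i\<in>{1..r}. D (\<tau> i) a [^]\<^bsub>dpoly_ring Y\<^esub> k i) \<in> \<aa>"
  moreover have "(\<Otimes>\<^bsub>dpoly_ring Y\<^esub>i\<in>{1..r}. D (\<tau> i) a [^]\<^bsub>dpoly_ring Y\<^esub> k i)
      = (\<Prod>i\<in>{1..r}. D (\<tau> i) a ^ k i)"
    unfolding dpoly_ring_pow using a D_closed by (intro dpoly_ring_finprod pow_in_dpoly_ring)
  moreover have "(\<Prod>i\<in>{1..r}. D (\<tau> i) a ^ k i) \<in> orbit_monoid D a"
    by (intro orbit_monoid_prod orbit_monoid_power orbit_monoid_conjugate)
  ultimately show "a \<in> \<aa>" using orbit[OF a] by simp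
qed

section \<open>The action on difference polynomials\<close>

locale difference_coefficients =
  fixes act :: "'g::group_add \<Rightarrow> 'k \<Rightarrow> 'k::field"
  assumes difference_ring: "difference_ring act ring_of_type_algebra"
begin

lemma act_hom: "act \<sigma> \<in> ring_hom ring_of_type_algebra ring_of_type_algebra"
  and act_add: "act (\<sigma> + \<tau>) x = act \<sigma> (act \<tau> x)" and act_zero: "act 0 x = x"
  using difference_ring by (auto simp: difference_ring_def ring_iso_def)

lemma pconst_act_hom: "(\<lambda>a. pconst (act \<sigma> a)) \<in> ring_hom ring_of_type_algebra ring_of_type_algebra"
  using act_hom[of \<sigma>] by (auto simp: type_ring_hom_iff single_add mult_single)

sublocale dact: poly_evaluation ring_of_type_algebra
  "\<lambda>a. pconst (act \<sigma> a)" "\<lambda>v. pvar (\<sigma> + fst v, snd v)" for \<sigma>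
  by (rule poly_evaluation_type[OF pconst_act_hom])

lemma dpoly_act_hom: "dpoly_act act \<sigma> \<in> ring_hom ring_of_type_algebra ring_of_type_algebra"
  unfolding dpoly_act_eq_poly_eval by (rule dact.eval_hom)

lemma dpoly_act_const [simp]: "dpoly_act act \<sigma> (pconst a) = pconst (act \<sigma> a)"
  and dpoly_act_var [simp]: "dpoly_act act \<sigma> (pvar v) = pvar (\<sigma> + fst v, snd v)"
  and dpoly_act_0 [simp]: "dpoly_act act \<sigma> 0 = 0"
  and dpoly_act_1 [simp]: "dpoly_act act \<sigma> 1 = 1"
  unfolding dpoly_act_eq_poly_eval
  using dact.eval_const dact.eval_var dact.eval_zero dact.eval_one by auto

text \<open>Fusion of two substitutions. It reduces equivariance of a substitution to a comparison
  on coefficients and variables.\<close>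

lemma poly_eval_dpoly_act:
  assumes "poly_evaluation B \<iota> c"
  shows "poly_eval B \<iota> c (dpoly_act act \<sigma> p)
    = poly_eval B (\<lambda>a. \<iota> (act \<sigma> a)) (\<lambda>v. c (\<sigma> + fst v, snd v)) p"
proof -
  interpret poly_evaluation B \<iota> c by fact
  show ?thesis
    unfolding dpoly_act_eq_poly_eval
    by (subst hom_poly_eval[OF dact.poly_evaluation_axioms B.is_cring eval_hom]) simp
qed

lemma dpoly_act_add: "dpoly_act act (\<sigma> + \<tau>) p = dpoly_act act \<sigma> (dpoly_act act \<tau> p)"
proof -
  have "dpoly_act act \<sigma> (dpoly_act act \<tau> p)
      = poly_eval ring_of_type_algebra (\<lambda>a. pconst (act \<sigma> (act \<tau> a)))
          (\<lambda>v. pvar (\<sigma> + (\<tau> + fst v), snd v)) p"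
    unfolding dpoly_act_eq_poly_eval[of act \<sigma>]
    by (subst poly_eval_dpoly_act[OF dact.poly_evaluation_axioms]) (simp only: fst_conv snd_conv)
  also have "\<dots> = dpoly_act act (\<sigma> + \<tau>) p"
    by (simp only: dpoly_act_eq_poly_eval act_add add.assoc)
  finally show ?thesis by (rule sym)
qed

lemma dpoly_act_zero: "dpoly_act act 0 p = p"
  by (simp add: dpoly_act_eq_poly_eval act_zero poly_eval_var)

lemma dpoly_act_in_dpoly_ring:
  assumes "p \<in> carrier (dpoly_ring Y)"
  shows "dpoly_act act \<sigma> p \<in> carrier (dpoly_ring Y)"
  unfolding dpoly_act_eq_poly_eval
  by (rule poly_eval_in_dpoly_ring) (auto intro!: pvar_in_dpoly_ring dest: dpoly_ring_keysD[OF assms])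

text \<open>Pulling back along \<open>restrict_vars Y\<close> extends an ideal of \<open>K{Y}\<close> to all polynomials of the
  type, so that the localization can be built over a type instead of a subring.\<close>

definition restrict_vars :: "'y set \<Rightarrow> ('g, 'y, 'k) dpoly \<Rightarrow> ('g, 'y, 'k) dpoly" where
  "restrict_vars Y = poly_eval ring_of_type_algebra pconst (\<lambda>v. if snd v \<in> Y then pvar v else 0)"

lemma restrict_vars_hom: "restrict_vars Y \<in> ring_hom ring_of_type_algebra ring_of_type_algebra"
  unfolding restrict_vars_def
  by (rule poly_evaluation.eval_hom[OF poly_evaluation_type[OF pconst_hom]])

lemma restrict_vars_in_dpoly_ring: "restrict_vars Y p \<in> carrier (dpoly_ring Y)"
  unfolding restrict_vars_def by (rule poly_eval_in_dpoly_ring) (auto simp: pvar_in_dpoly_ring simp del: One_nat_def)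

lemma restrict_vars_id:
  assumes "p \<in> carrier (dpoly_ring Y)"
  shows "restrict_vars Y p = p"
proof -
  have "restrict_vars Y p = poly_eval ring_of_type_algebra pconst pvar p"
    unfolding restrict_vars_def
    by (rule poly_eval_cong) (auto simp: cring_from_type_algebra dest: dpoly_ring_keysD[OF assms])
  then show ?thesis by (simp only: poly_eval_var)
qed

text \<open>The action changes only the group component of a variable, so it does not affect whether
  the variable is kept or sent to 0; both sides are the same substitution.\<close>

lemma restrict_vars_dpoly_act:
  "restrict_vars Y (dpoly_act act \<sigma> p) = dpoly_act act \<sigma> (restrict_vars Y p)"
  unfolding restrict_vars_def
  by (subst poly_eval_dpoly_act[OF poly_evaluation_type[OF pconst_hom]],
      subst hom_poly_eval[OF poly_evaluation_type[OF pconst_hom] cring_from_type_algebra dpoly_act_hom])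
     (simp add: if_distrib[of "dpoly_act act \<sigma>"] cong: if_cong)

text \<open>The preimage of a perfect ideal under an equivariant homomorphism is perfect, because
  orbit monoids map into orbit monoids. It avoids \<open>f\<close> because
  \<open>restrict_vars Y\<close> fixes K{Y}.\<close>

lemma perfect_ideal_complement_restrict_vars:
  assumes "perfect_difference_ideal (dpoly_act act) \<tt> (dpoly_ring Y)"
    and "f \<in> carrier (dpoly_ring Y)" "f \<notin> \<tt>"
  shows "perfect_ideal_complement (dpoly_act act) {p. restrict_vars Y p \<in> \<tt>} f"
proof -
  have I: "ideal \<tt> (dpoly_ring Y)" and stable: "dpoly_act act \<sigma> ` \<tt> \<subseteq> \<tt>" for \<sigma>
    using assms by (auto simp: perfect_difference_ideal_def difference_ideal_def)
  have \<rho>: "restrict_vars Y (p + q) = restrict_vars Y p + restrict_vars Y q"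
    "restrict_vars Y (p * q) = restrict_vars Y p * restrict_vars Y q" "restrict_vars Y 1 = 1" for p q
    using restrict_vars_hom[of Y] by (auto simp: type_ring_hom_iff)
  have \<rho>0: "restrict_vars Y 0 = 0" by (simp add: restrict_vars_id)
  have 0: "0 \<in> \<tt>" and add: "p \<in> \<tt> \<Longrightarrow> q \<in> \<tt> \<Longrightarrow> p + q \<in> \<tt>"
    and mult: "p \<in> \<tt> \<Longrightarrow> r \<in> carrier (dpoly_ring Y) \<Longrightarrow> r * p \<in> \<tt>" for p q r
    using additive_subgroup.zero_closed[OF ideal.axioms(1)[OF I]]
      additive_subgroup.a_closed[OF ideal.axioms(1)[OF I]] ideal.I_l_closed[OF I] by auto
  have D: "p \<in> \<tt> \<Longrightarrow> dpoly_act act \<sigma> p \<in> \<tt>" for \<sigma> p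
    using stable by blast
  show ?thesis
  proof
    fix x a assume "x \<in> orbit_monoid (dpoly_act act) a" "x \<in> {p. restrict_vars Y p \<in> \<tt>}"
    moreover from this have "restrict_vars Y x \<in> orbit_monoid (dpoly_act act) (restrict_vars Y a)"
      by (intro orbit_monoid_image[where h = "restrict_vars Y" and x = x and D = "dpoly_act act"])
         (auto simp: \<rho> restrict_vars_dpoly_act intro: orbit_monoid_conjugate)
    ultimately show "a \<in> {p. restrict_vars Y p \<in> \<tt>}"
      using perfect_difference_ideal_orbitD[OF assms(1)]
      by (auto simp: dpoly_act_in_dpoly_ring restrict_vars_in_dpoly_ring)
  qed (use assms in \<open>auto simp: dpoly_act_hom dpoly_act_add dpoly_act_zero \<rho> \<rho>0 0 add mult D
      restrict_vars_in_dpoly_ring restrict_vars_dpoly_act restrict_vars_id\<close>)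
qed

section \<open>The Nullstellensatz\<close>

lemma dpoly_eval_hom:
  "dpoly_eval (\<lambda>a. a) act ring_of_type_algebra b \<in> ring_hom ring_of_type_algebra ring_of_type_algebra"
  unfolding dpoly_eval_eq_poly_eval
  by (rule poly_evaluation.eval_hom, rule poly_evaluation_type) (auto simp: type_ring_hom_iff)

section \<open>Moving polynomials from K{Y} to K{Z}\<close>

definition rename_vars :: "('y \<Rightarrow> 'z) \<Rightarrow> ('g, 'y, 'k) dpoly \<Rightarrow> ('g, 'z, 'k) dpoly" where
  "rename_vars j = poly_eval ring_of_type_algebra pconst (\<lambda>v. pvar (fst v, j (snd v)))"

lemma rename_vars_in_dpoly_ring:
  assumes "p \<in> carrier (dpoly_ring Y)" "j ` Y \<subseteq> Z"
  shows "rename_vars j p \<in> carrier (dpoly_ring Z)"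
  unfolding rename_vars_def
  by (rule poly_eval_in_dpoly_ring) (use assms(2) dpoly_ring_keysD[OF assms(1)] in \<open>auto intro!: pvar_in_dpoly_ring\<close>)

lemma poly_eval_rename_vars:
  assumes "poly_evaluation B \<iota> c"
  shows "poly_eval B \<iota> c (rename_vars j p) = poly_eval B \<iota> (\<lambda>v. c (fst v, j (snd v))) p"
proof -
  interpret poly_evaluation B \<iota> c by fact
  show ?thesis
    unfolding rename_vars_def
    by (subst hom_poly_eval[OF poly_evaluation_type[OF pconst_hom] B.is_cring eval_hom]) simp
qed

text \<open>\<open>common_zeros\<close> asks for points that are extensional on \<open>Y\<close>,
  hence the \<open>restrict\<close>; it does not change the value, as all variables of
  \<open>p\<close> lie over \<open>Y\<close>.\<close>

lemma dpoly_eval_rename_vars: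
  assumes "p \<in> carrier (dpoly_ring Y)"
  shows "dpoly_eval (\<lambda>a. a) act ring_of_type_algebra c (rename_vars j p)
    = dpoly_eval (\<lambda>a. a) act ring_of_type_algebra (restrict (c \<circ> j) Y) p"
proof -
  have "dpoly_eval (\<lambda>a. a) act ring_of_type_algebra c (rename_vars j p)
      = poly_eval ring_of_type_algebra (\<lambda>a. a) (\<lambda>v. act (fst v) (c (j (snd v)))) p"
    unfolding dpoly_eval_eq_poly_eval
    by (subst poly_eval_rename_vars) (auto intro!: poly_evaluation_type simp: type_ring_hom_iff)
  also have "\<dots> = poly_eval ring_of_type_algebra (\<lambda>a. a) (\<lambda>v. act (fst v) (restrict (c \<circ> j) Y (snd v))) p"
    by (rule poly_eval_cong) (auto simp: cring_from_type_algebra dest: dpoly_ring_keysD[OF assms])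
  finally show ?thesis
    by (simp only: dpoly_eval_eq_poly_eval)
qed

lemma exists_rabinowitsch_ideal:
  fixes j :: "'y \<Rightarrow> 'z" and f :: "('g, 'y, 'k) dpoly"
  assumes perf: "perfect_difference_ideal (dpoly_act act) \<tt> (dpoly_ring Y)"
    and f: "f \<in> carrier (dpoly_ring Y)" "f \<notin> \<tt>"
    and j: "inj_on j Y" "j ` Y \<subseteq> Z" "w \<in> Z" "w \<notin> j ` Y"
  obtains \<aa> where "perfect_difference_ideal (dpoly_act act) \<aa> (dpoly_ring Z)"
    "\<aa> \<noteq> carrier (dpoly_ring Z)"
    "\<And>p. p \<in> \<tt> \<Longrightarrow> rename_vars j p \<in> \<aa>"
    "pvar (0, w) * rename_vars j f - 1 \<in> \<aa>"
proof -
  interpret perfect_ideal_complement "dpoly_act act" "{p. restrict_vars Y p \<in> \<tt>}" f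
    by (rule perfect_ideal_complement_restrict_vars[OF perf f])
  define c where "c v = (if snd v = w then fraction 1 (dpoly_act act (fst v) f)
    else if snd v \<in> j ` Y then fraction (pvar (fst v, inv_into Y j (snd v))) 1 else fraction 0 1)"
    for v :: "'g \<times> 'z"
  define \<iota> where "\<iota> a = fraction (pconst a) 1" for a :: 'k
  define \<phi> where "\<phi> = poly_eval frac_ring \<iota> c"
  have \<iota>: "\<iota> \<in> ring_hom ring_of_type_algebra frac_ring"
    using ring_hom_trans[OF pconst_hom frac_hom] by (simp add: \<iota>_def o_def cong: ring_hom_def)
  interpret \<phi>: poly_evaluation frac_ring \<iota> c
    by (intro poly_evaluation.intro cring_frac_ring poly_evaluation_axioms.intro \<iota>) (auto simp: c_def)
  \<comment> \<open>Both sides are substitutions into the localization, so it is enough that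
    \<open>\<iota>\<close> and \<open>c\<close> are equivariant.\<close>
  have \<phi>_act: "\<phi> (dpoly_act act \<sigma> q) = frac_map (dpoly_act act \<sigma>) (\<phi> q)" for \<sigma> q
  proof -
    have "frac_map (dpoly_act act \<sigma>) (\<phi> q)
        = poly_eval frac_ring (\<lambda>a. frac_map (dpoly_act act \<sigma>) (\<iota> a)) (\<lambda>v. frac_map (dpoly_act act \<sigma>) (c v)) q"
      unfolding \<phi>_def by (rule hom_poly_eval[OF \<phi>.poly_evaluation_axioms cring_frac_ring frac_map_D_hom])
    also have "\<dots> = poly_eval frac_ring (\<lambda>a. \<iota> (act \<sigma> a)) (\<lambda>v. c (\<sigma> + fst v, snd v)) q"
      by (rule arg_cong2[where f = "\<lambda>g h. poly_eval frac_ring g h q"])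
         (auto simp: fun_eq_iff \<iota>_def c_def frac_map_D_fraction dpoly_act_add)
    finally show ?thesis
      by (simp only: \<phi>_def poly_eval_dpoly_act[OF \<phi>.poly_evaluation_axioms])
  qed
  have \<phi>_rename: "\<phi> (rename_vars j p) = fraction p 1" if "p \<in> carrier (dpoly_ring Y)" for p
  proof -
    have "\<phi> (rename_vars j p) = poly_eval frac_ring \<iota> (\<lambda>v. c (fst v, j (snd v))) p"
      unfolding \<phi>_def by (rule poly_eval_rename_vars[OF \<phi>.poly_evaluation_axioms])
    also have "\<dots> = poly_eval frac_ring (\<lambda>a. fraction (pconst a) 1) (\<lambda>v. fraction (pvar v) 1) p"
    proof (rule poly_eval_cong)
      fix m v assume "m \<in> Poly_Mapping.keys p" "v \<in> Poly_Mapping.keys m"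
      then have "snd v \<in> Y" by (rule dpoly_ring_keysD[OF that])
      then show "c (fst v, j (snd v)) = fraction (pvar v) 1"
        using j by (auto simp: c_def inv_into_f_f)
    qed (simp_all add: \<iota>_def cring_frac_ring)
    also have "\<dots> = fraction (poly_eval ring_of_type_algebra pconst pvar p) 1"
      by (rule hom_poly_eval[OF poly_evaluation_type[OF pconst_hom] cring_frac_ring frac_hom, symmetric])
    finally show ?thesis by (simp only: poly_eval_var)
  qed
  \<comment> \<open>The map \<open>\<phi>\<close> is defined on all polynomials of the type; its
    kernel is cut down to K{Z}, the ring to which (B1) refers.\<close>
  define \<aa> where "\<aa> = {q \<in> carrier (dpoly_ring Z). \<phi> q = \<zero>\<^bsub>frac_ring\<^esub>}"
  have ideal: "ideal \<aa> (dpoly_ring Z)"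
  proof -
    have "\<phi> \<in> ring_hom (dpoly_ring Z) frac_ring"
      unfolding \<phi>_def by (rule ring_hom_memI) (auto simp: \<phi>.eval_add \<phi>.eval_mult)
    from ring_hom_ring.kernel_is_ideal[OF ring_hom_ringI2[OF cring.axioms(1)[OF cring_dpoly_ring]
        cring.axioms(1)[OF cring_frac_ring] this]]
    show ?thesis by (simp only: \<aa>_def a_kernel_def')
  qed
  have T_zero': "fraction p 1 = \<zero>\<^bsub>frac_ring\<^esub>" if "p \<in> \<tt>" "p \<in> carrier (dpoly_ring Y)" for p
    using that by (auto simp: frac_eq_zero_iff restrict_vars_id intro!: bexI[of _ 1])
  have t_carrier: "\<tt> \<subseteq> carrier (dpoly_ring Y)"
    using perf additive_subgroup.a_subset[OF ideal.axioms(1)]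
    by (auto simp: perfect_difference_ideal_def difference_ideal_def)
  show thesis
  proof
    have map0: "frac_map (dpoly_act act \<sigma>) \<zero>\<^bsub>frac_ring\<^esub> = \<zero>\<^bsub>frac_ring\<^esub>" for \<sigma>
      by (simp add: frac_zero frac_map_D_fraction)
    show "perfect_difference_ideal (dpoly_act act) \<aa> (dpoly_ring Z)"
    proof (rule perfect_difference_idealI)
      show "difference_ideal (dpoly_act act) \<aa> (dpoly_ring Z)"
        unfolding difference_ideal_def
      proof (intro conjI allI ideal image_subsetI)
        fix \<sigma> q assume "q \<in> \<aa>"
        then show "dpoly_act act \<sigma> q \<in> \<aa>"
          by (simp add: \<aa>_def dpoly_act_in_dpoly_ring \<phi>_act map0)
      qed
    next
      fix q x assume "q \<in> carrier (dpoly_ring Z)" "x \<in> orbit_monoid (dpoly_act act) q" "x \<in> \<aa>"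
      then show "q \<in> \<aa>"
        using kernel_perfect[OF \<phi>.eval_hom[folded \<phi>_def] \<phi>_act] unfolding \<aa>_def by blast
    qed (rule dpoly_act_in_dpoly_ring)
    show "\<aa> \<noteq> carrier (dpoly_ring Z)"
    proof
      assume "\<aa> = carrier (dpoly_ring Z)"
      then have "1 \<in> \<aa>" by simp
      then show False using frac_ring_one_neq_zero by (simp add: \<aa>_def \<phi>_def)
    qed
    show "rename_vars j p \<in> \<aa>" if "p \<in> \<tt>" for p
      using that t_carrier rename_vars_in_dpoly_ring[of p Y j Z] j T_zero'
      by (auto simp: \<aa>_def \<phi>_rename)
    let ?e = "pvar (0, w) * rename_vars j f - 1 :: ('g, 'z, 'k) dpoly"
    have "?e \<in> carrier (dpoly_ring Z)"
      using rename_vars_in_dpoly_ring[OF f(1) j(2)] j(3)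
        add_in_dpoly_ring[OF mult_in_dpoly_ring uminus_in_dpoly_ring, of "pvar (0, w)" Z "rename_vars j f" 1]
      by (simp add: pvar_in_dpoly_ring)
    moreover have "\<phi> ?e = \<zero>\<^bsub>frac_ring\<^esub>"
    proof -
      \<comment> \<open>Adding 1 removes the subtraction: the sum is (1/f) * f = 1, and cancelling
        leaves \<open>\<phi> ?e\<close> zero. The group component 0 of the variable makes its value
        1/f itself.\<close>
      have "\<phi> ?e \<oplus>\<^bsub>frac_ring\<^esub> \<one>\<^bsub>frac_ring\<^esub> = \<phi> (?e + 1)"
        unfolding \<phi>_def by (simp only: \<phi>.eval_add \<phi>.eval_one)
      also have "\<dots> = c (0, w) \<otimes>\<^bsub>frac_ring\<^esub> fraction f 1"
        using \<phi>_rename[OF f(1)] by (simp add: \<phi>_def \<phi>.eval_mult)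
      also have "\<dots> = \<one>\<^bsub>frac_ring\<^esub>"
        unfolding c_def frac_one using conjugate_f
        by (simp add: dpoly_act_zero) (rule frac_eqI, simp_all)
      finally show ?thesis
        by (simp add: \<phi>_def)
    qed
    ultimately show "?e \<in> \<aa>" by (simp add: \<aa>_def)
  qed
qed

end

text \<open>An infinite \<open>Z\<close> absorbs one additional point, so the disjoint sum of
  \<open>Y\<close> and a singleton embeds into it; the singleton supplies \<open>w\<close>. This
  also covers the case where \<open>Y\<close> has the full cardinality of \<open>Z\<close>.\<close>

lemma exists_inj_spare_point:
  assumes "Cinfinite \<kappa>" "|Z| =o \<kappa>" "|Y| \<le>o \<kappa>"
  obtains j w where "inj_on j Y" "j ` Y \<subseteq> Z" "w \<in> Z" "w \<notin> j ` Y"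
proof -
  have "|Y| \<le>o |Z|"
    using assms(2,3) ordIso_symmetric ordLeq_ordIso_trans by blast
  moreover have "infinite Z"
    using assms(1,2) Cinfinite_cong[OF ordIso_symmetric[OF assms(2)]]
    by (auto simp: cinfinite_def Field_card_of)
  ultimately have "|Y <+> {()}| \<le>o |Z|"
    by (intro card_of_Plus_ordLeq_infinite_Field)
       (auto simp: Field_card_of card_of_card_order_on intro!: card_of_singl_ordLeq)
  then obtain h where h: "inj_on h (Y <+> {()})" "h ` (Y <+> {()}) \<subseteq> Z"
    by (auto simp flip: card_of_ordLeq)
  show thesis
  proof
    show "inj_on (h \<circ> Inl) Y" "(h \<circ> Inl) ` Y \<subseteq> Z" "h (Inr ()) \<in> Z" "h (Inr ()) \<notin> (h \<circ> Inl) ` Y"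
      using h by (auto simp: inj_on_def)
  qed
qed

theorem theorem17:
  fixes act :: "'g::group_add \<Rightarrow> 'k \<Rightarrow> 'k::field"
    and \<kappa> :: "'c rel"
    and Z :: "'z set"
    and Y :: "'y set"
    and \<tt> :: "('g, 'y, 'k) dpoly set"
  assumes "Cinfinite \<kappa>"
    and "|Z| =o \<kappa>"
    and "closed_difference_field act Z"
    and "|Y| \<le>o \<kappa>"
    and "perfect_difference_ideal (dpoly_act act) \<tt> (dpoly_ring Y)"
  shows "\<tt> = vanishing_ideal act Y (zero_set act Y \<tt>)"
proof
  let ?ev = "\<lambda>b. dpoly_eval (\<lambda>a. a) act (ring_of_type_algebra :: 'k ring) b"
  interpret difference_coefficients act
    using assms(3) by unfold_locales (simp add: closed_difference_field_def difference_field_def)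
  have t_carrier: "\<tt> \<subseteq> carrier (dpoly_ring Y)"
    using assms(5) additive_subgroup.a_subset[OF ideal.axioms(1)]
    by (auto simp: perfect_difference_ideal_def difference_ideal_def)
  then show "\<tt> \<subseteq> vanishing_ideal act Y (zero_set act Y \<tt>)"
    by (auto simp: vanishing_ideal_def zero_set_def common_zeros_def)
  show "vanishing_ideal act Y (zero_set act Y \<tt>) \<subseteq> \<tt>"
  proof (rule subsetI, rule ccontr)
    fix f assume f: "f \<in> vanishing_ideal act Y (zero_set act Y \<tt>)" "f \<notin> \<tt>"
    then have fY: "f \<in> carrier (dpoly_ring Y)" by (simp add: vanishing_ideal_def)
    obtain j w where j: "inj_on j Y" "j ` Y \<subseteq> Z" "w \<in> Z" "w \<notin> j ` Y"
      using exists_inj_spare_point[OF assms(1,2,4)] .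
    obtain \<aa> where \<aa>: "perfect_difference_ideal (dpoly_act act) \<aa> (dpoly_ring Z)"
      "\<aa> \<noteq> carrier (dpoly_ring Z)"
      "\<And>p. p \<in> \<tt> \<Longrightarrow> rename_vars j p \<in> \<aa>"
      "pvar (0, w) * rename_vars j f - 1 \<in> \<aa>"
      using exists_rabinowitsch_ideal[OF assms(5) fY f(2) j] by blast
    obtain c where "c \<in> zero_set act Z \<aa>"
      using assms(3) \<aa>(1,2) unfolding closed_difference_field_def closed_B1_def by blast
    then have c: "?ev c q = 0" if "q \<in> \<aa>" for q
      using that by (auto simp: zero_set_def common_zeros_def)
    \<comment> \<open>The \<open>Y\<close>-part of \<open>c\<close>: its values at polynomials of
      K{Y} are those of \<open>c\<close> at the renamed polynomials, so it is a zero of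
      \<open>\<tt>\<close>.\<close>
    define b where "b = restrict (c \<circ> j) Y"
    have b: "?ev b p = ?ev c (rename_vars j p)" if "p \<in> carrier (dpoly_ring Y)" for p
      unfolding b_def by (rule dpoly_eval_rename_vars[OF that, symmetric])
    have "b \<in> zero_set act Y \<tt>"
      using b t_carrier c \<aa>(3) by (auto simp: zero_set_def common_zeros_def b_def)
    with f(1) have "?ev b f = 0" by (simp add: vanishing_ideal_def)
    then have 0: "?ev c (rename_vars j f) = 0" using b[OF fY] by simp
    let ?e = "pvar (0, w) * rename_vars j f - 1 :: ('g, 'z, 'k) dpoly"
    have hom: "?ev c (p + q) = ?ev c p + ?ev c q" "?ev c (p * q) = ?ev c p * ?ev c q" "?ev c 1 = 1" for p q
      using dpoly_eval_hom[of c] by (auto simp: type_ring_hom_iff)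
    \<comment> \<open>As \<open>?e\<close> vanishes at \<open>c\<close>, the value of
      \<open>f\<close> at \<open>b\<close> has the coordinate of \<open>c\<close> at
      \<open>w\<close> as an inverse, contradicting that it is 0.\<close>
    have "?ev c (?e + 1) = ?ev c ?e + 1" by (simp only: hom)
    then have "?ev c (pvar (0, w)) * ?ev c (rename_vars j f) = 1"
      using c[OF \<aa>(4)] by (simp add: hom)
    with 0 show False by simp
  qed
qed

end
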